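(* Let $G$ be a non-trivial connected graph. (a) The following are equivalent: (i) $G$ is complete; (ii) $\mathrm{diam}(G)=1$; (iii) $rc(G)=1$; (iv) $src(G)=1$; (v) $rvc(G)=0$; (vi) $srvc(G)=0$; (vii) $trc(G)=1$; (viii) $strc(G)=1$. (b) $strc(G)\ge trc(G)\ge 3$ if and only if $G$ is not a complete graph. (c) (i) $rc(G)=2$ iff $src(G)=2$. (ii) $rvc(G)=1$ iff $srvc(G)=1$ iff $\mathrm{diam}(G)=2$. (iii) $rvc(G)=2$ iff $srvc(G)=2$. (iv) $trc(G)=3$ iff $strc(G)=3$. (v) $trc(G)=4$ iff $strc(G)=4$. Moreover, any of the conditions in (i) implies any of the conditions in (iv), and any of the conditions in (i), (iv) and (v) implies any of the conditions in (ii).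
   Context: All graphs are finite and simple; $u$–$v$ geodesic means a $u$–$v$ path of length $d(u,v)$. An edge-coloured path is rainbow if its edges have distinct colours; $rc(G)$ (resp. $src(G)$) is the minimum number of colours in an edge-colouring of $G$ in which any two vertices are joined by a rainbow path (resp. rainbow geodesic). A vertex-coloured path is vertex-rainbow if its internal vertices have distinct colours; $rvc(G)$ (resp. $srvc(G)$) is the minimum number of colours in a vertex-colouring in which any two vertices are joined by a vertex-rainbow path (resp. vertex-rainbow geodesic), with value $0$ for complete graphs. A total-coloured path is total-rainbow if its edges and internal vertices have pairwise distinct colours; $trc(G)$ (resp. $strc(G)$) is the minimum number of colours in a total-colouring (vertices and edges) in which any two vertices are joined by a total-rainbow path (resp. total-rainbow geodesic). *)

theory Defs
  imports "Graph_Theory.Graph_Theory" "HOL-Library.FuncSet"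
begin

text \<open>
  A finite simple graph is a symmetric digraph without loops and parallel arcs (locale
  \<^locale>\<open>graph\<close>). An undirected edge is thus a pair of opposite arcs, identified here with its
  set of two ends, so that colourings of undirected edges are functions on these sets.
\<close>

definition uedge :: "('a, 'b) pre_digraph \<Rightarrow> 'b \<Rightarrow> 'a set" where
  "uedge G e = {tail G e, head G e}"

definition uedges :: "('a, 'b) pre_digraph \<Rightarrow> 'a set set" where
  "uedges G = uedge G ` arcs G"

definition complete_graph :: "('a, 'b) pre_digraph \<Rightarrow> bool" where
  "complete_graph G \<longleftrightarrow> (\<exists>n. complete_digraph n G)"

definition gdist :: "('a, 'b) pre_digraph \<Rightarrow> 'a \<Rightarrow> 'a \<Rightarrow> ereal" where
  "gdist G u v = wf_digraph.\<mu> G (\<lambda>_. 1) u v"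

definition gdiam :: "('a, 'b) pre_digraph \<Rightarrow> ereal" where
  "gdiam G = (SUP u\<in>verts G. SUP v\<in>verts G. gdist G u v)"

abbreviation gpath :: "('a, 'b) pre_digraph \<Rightarrow> 'a \<Rightarrow> 'b awalk \<Rightarrow> 'a \<Rightarrow> bool" where
  "gpath G u p v \<equiv> pre_digraph.apath G u p v"

definition geodesic :: "('a, 'b) pre_digraph \<Rightarrow> 'a \<Rightarrow> 'b awalk \<Rightarrow> 'a \<Rightarrow> bool" where
  "geodesic G u p v \<longleftrightarrow> gpath G u p v \<and> ereal (real (length p)) = gdist G u v"

definition internal_verts :: "('a, 'b) pre_digraph \<Rightarrow> 'a \<Rightarrow> 'b awalk \<Rightarrow> 'a list" where
  "internal_verts G u p = butlast (tl (pre_digraph.awalk_verts G u p))"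

definition rainbow :: "('a, 'b) pre_digraph \<Rightarrow> ('a set \<Rightarrow> nat) \<Rightarrow> 'b awalk \<Rightarrow> bool" where
  "rainbow G c p \<longleftrightarrow> distinct (map (\<lambda>e. c (uedge G e)) p)"

definition vertex_rainbow ::
    "('a, 'b) pre_digraph \<Rightarrow> ('a \<Rightarrow> nat) \<Rightarrow> 'a \<Rightarrow> 'b awalk \<Rightarrow> bool" where
  "vertex_rainbow G c u p \<longleftrightarrow> distinct (map c (internal_verts G u p))"

text \<open>A total-colouring is a function on the disjoint union of the vertices and the edges.\<close>

definition total_rainbow ::
    "('a, 'b) pre_digraph \<Rightarrow> ('a + 'a set \<Rightarrow> nat) \<Rightarrow> 'a \<Rightarrow> 'b awalk \<Rightarrow> bool" where
  "total_rainbow G c u p \<longleftrightarrow>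
     distinct (map (\<lambda>e. c (Inr (uedge G e))) p @ map (\<lambda>w. c (Inl w)) (internal_verts G u p))"

text \<open>
  Colourings need not be proper. For \<open>u = v\<close> the empty path qualifies in all six definitions, so
  that it makes no difference whether the two vertices are required to be distinct.
\<close>

definition rc :: "('a, 'b) pre_digraph \<Rightarrow> nat" where
  "rc G = (LEAST k. \<exists>c \<in> uedges G \<rightarrow> {1..k}.
     \<forall>u\<in>verts G. \<forall>v\<in>verts G. \<exists>p. gpath G u p v \<and> rainbow G c p)"

definition src :: "('a, 'b) pre_digraph \<Rightarrow> nat" where
  "src G = (LEAST k. \<exists>c \<in> uedges G \<rightarrow> {1..k}.
     \<forall>u\<in>verts G. \<forall>v\<in>verts G. \<exists>p. geodesic G u p v \<and> rainbow G c p)"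

text \<open>
  The value for complete graphs is a convention: a vertex-colouring of a non-empty graph uses at
  least one colour, even if no path has an internal vertex.
\<close>

definition rvc :: "('a, 'b) pre_digraph \<Rightarrow> nat" where
  "rvc G = (if complete_graph G then 0 else (LEAST k. \<exists>c \<in> verts G \<rightarrow> {1..k}.
     \<forall>u\<in>verts G. \<forall>v\<in>verts G. \<exists>p. gpath G u p v \<and> vertex_rainbow G c u p))"

definition srvc :: "('a, 'b) pre_digraph \<Rightarrow> nat" where
  "srvc G = (if complete_graph G then 0 else (LEAST k. \<exists>c \<in> verts G \<rightarrow> {1..k}.
     \<forall>u\<in>verts G. \<forall>v\<in>verts G. \<exists>p. geodesic G u p v \<and> vertex_rainbow G c u p))"

definition trc :: "('a, 'b) pre_digraph \<Rightarrow> nat" where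
  "trc G = (LEAST k. \<exists>c \<in> (verts G <+> uedges G) \<rightarrow> {1..k}.
     \<forall>u\<in>verts G. \<forall>v\<in>verts G. \<exists>p. gpath G u p v \<and> total_rainbow G c u p)"

definition strc :: "('a, 'b) pre_digraph \<Rightarrow> nat" where
  "strc G = (LEAST k. \<exists>c \<in> (verts G <+> uedges G) \<rightarrow> {1..k}.
     \<forall>u\<in>verts G. \<forall>v\<in>verts G. \<exists>p. geodesic G u p v \<and> total_rainbow G c u p)"

end

theory Submission
  imports Defs
begin

text \<open>
  A path that is rainbow in one of the three senses for few colours is short: it has at most \<open>k\<close>
  edges, \<open>k\<close> internal vertices, or \<open>k\<close> edges and internal vertices altogether. A shortest path
  between the same ends can only differ from it by being strictly shorter still, and for the values
  of \<open>k\<close> in question it is then so short that every colouring makes it rainbow. So the colouring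
  also works with geodesics, and the strong parameter agrees with the weak one.
\<close>

section \<open>Least numbers of colours\<close>

definition min_colours :: "'c set \<Rightarrow> (('c \<Rightarrow> nat) \<Rightarrow> bool) \<Rightarrow> nat" where
  "min_colours A P = (LEAST k. \<exists>c \<in> A \<rightarrow> {1..k}. P c)"

lemma min_colours_le:
  assumes "c \<in> A \<rightarrow> {1..k}" "P c"
  shows "min_colours A P \<le> k"
  unfolding min_colours_def using assms by (blast intro: Least_le)

text \<open>\<open>LEAST\<close> is meaningful only if some number of colours works. On a finite set
  an injective colouring exists, so it is enough that \<open>P\<close> holds for injective
  colourings.\<close>

lemma min_colours_witness:
  assumes "finite A" "\<And>c. inj_on c A \<Longrightarrow> P c"
  shows "\<exists>c \<in> A \<rightarrow> {1..min_colours A P}. P c"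
proof -
  obtain f :: "'a \<Rightarrow> nat" and n where f: "f ` A = {i. i < n}" "inj_on f A"
    using finite_imp_inj_to_nat_seg[OF assms(1)] by blast
  \<comment> \<open>The injection \<open>f\<close> takes values from 0 to n - 1, whereas colours are
    counted from 1.\<close>
  have "inj_on (Suc \<circ> f) A"
    using f(2) by (simp add: comp_inj_on)
  moreover have "Suc \<circ> f \<in> A \<rightarrow> {1..n}"
    using f(1) by (auto simp: Suc_le_eq)
  ultimately have "\<exists>k. \<exists>c \<in> A \<rightarrow> {1..k}. P c"
    using assms(2) by blast
  then show ?thesis
    unfolding min_colours_def by (rule LeastI_ex)
qed

text \<open>For k = 0 the palette {1..k} is empty, so a non-empty set has no colouring at
  all.\<close>

lemma min_colours_pos:
  assumes "finite A" "A \<noteq> {}" "\<And>c. inj_on c A \<Longrightarrow> P c"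
  shows "1 \<le> min_colours A P"
  using min_colours_witness[OF assms(1,3)] assms(2) by fastforce

text \<open>Only an optimal colouring for \<open>P\<close> has to satisfy \<open>Q\<close>. Thus a
  bound on the number of colours may be used in passing from \<open>P\<close> to \<open>Q\<close>,
  as the comparison of weak and strong parameters requires.\<close>

lemma min_colours_mono:
  assumes "finite A" "\<And>c. inj_on c A \<Longrightarrow> P c"
    and "\<And>c. c \<in> A \<rightarrow> {1..min_colours A P} \<Longrightarrow> P c \<Longrightarrow> Q c"
  shows "min_colours A Q \<le> min_colours A P"
proof -
  obtain c where "c \<in> A \<rightarrow> {1..min_colours A P}" "P c"
    using min_colours_witness[of A P] assms(1,2) by blast
  then show ?thesis
    using assms(3) by (intro min_colours_le[of c]) blast+
qed

lemma length_distinct_le: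
  assumes "distinct xs" "set xs \<subseteq> {1..k}"
  shows "length xs \<le> k"
  using assms card_mono[of "{1..k}" "set xs"] by (simp add: distinct_card)

section \<open>Distances, geodesics and diameter\<close>

definition reaches_within :: "('a, 'b) pre_digraph \<Rightarrow> nat \<Rightarrow> bool" where
  "reaches_within G n \<longleftrightarrow>
     (\<forall>u\<in>verts G. \<forall>v\<in>verts G. \<exists>p. gpath G u p v \<and> length p \<le> n)"

locale nontrivial_connected_graph = graph +
  assumes connected: "connected G" and two_verts: "2 \<le> card (verts G)"
begin

lemma gdist_le_length:
  assumes "gpath G u p v"
  shows "gdist G u v \<le> ereal (real (length p))"
  using min_cost_le_walk_cost[of u p v "\<lambda>_. 1"] assms
  by (simp add: gdist_def apath_def awalk_cost_def sum_list_triv)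

text \<open>With unit costs no closed walk has negative cost, so a path of minimal cost exists
  between mutually reachable vertices. Symmetry of the arcs turns connectedness into
  reachability.\<close>

lemma ex_geodesic:
  assumes "u \<in> verts G" "v \<in> verts G"
  shows "\<exists>p. geodesic G u p v"
proof -
  have "u \<rightarrow>\<^sup>* v"
    using symmetric_connected_imp_strongly_connected[OF sym_arcs connected] assms by auto
  moreover have "\<not> (\<exists>w c. awalk w c w \<and> w \<in> set (awalk_verts u p) \<and> awalk_cost (\<lambda>_. 1) c < 0)"
    for p
    by (simp add: awalk_cost_def sum_list_triv)
  ultimately have "\<exists>p. apath u p v \<and> \<mu> (\<lambda>_. 1) u v = awalk_cost (\<lambda>_. 1) p"
    by (rule no_neg_cyc_reach_imp_path)
  then show ?thesis
    by (auto simp: geodesic_def gdist_def awalk_cost_def sum_list_triv)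
qed

text \<open>A path that is not a geodesic has length different from the distance, hence larger.
  Keeping \<open>p\<close> itself in the other case keeps whatever rainbow property \<open>p\<close>
  has.\<close>

lemma geodesic_eq_or_shorter:
  assumes p: "gpath G u p v"
  shows "\<exists>q. geodesic G u q v \<and> (q = p \<or> length q < length p)"
proof (cases "geodesic G u p v")
  case False
  obtain q where q: "geodesic G u q v"
    using ex_geodesic awalk_hd_in_verts awalk_last_in_verts awalkI_apath[OF p] by blast
  then have d: "gdist G u v = ereal (real (length q))"
    by (simp add: geodesic_def)
  have "length q \<noteq> length p"
    using False p d by (simp add: geodesic_def)
  moreover have "length q \<le> length p"
    using gdist_le_length[OF p] d by simp
  ultimately have "length q < length p"
    by simp
  then show ?thesis
    using q by auto
qed auto

lemma reaches_within_iff_gdist: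
  "reaches_within G n \<longleftrightarrow> (\<forall>u\<in>verts G. \<forall>v\<in>verts G. gdist G u v \<le> ereal (real n))"
proof
  assume "reaches_within G n"
  then show "\<forall>u\<in>verts G. \<forall>v\<in>verts G. gdist G u v \<le> ereal (real n)"
    unfolding reaches_within_def
    by (meson gdist_le_length ereal_less_eq(3) of_nat_le_iff order_trans)
next
  assume d: "\<forall>u\<in>verts G. \<forall>v\<in>verts G. gdist G u v \<le> ereal (real n)"
  show "reaches_within G n"
    unfolding reaches_within_def
  proof (intro ballI)
    fix u v assume uv: "u \<in> verts G" "v \<in> verts G"
    then obtain p where p: "geodesic G u p v"
      using ex_geodesic by blast
    then have "ereal (real (length p)) \<le> ereal (real n)"
      using d uv by (simp add: geodesic_def)
    then show "\<exists>p. gpath G u p v \<and> length p \<le> n"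
      using p by (auto simp: geodesic_def)
  qed
qed

text \<open>This allows diameters to be treated through lengths of paths, in natural numbers,
  instead of suprema of extended reals.\<close>

lemma reaches_within_iff_gdiam: "reaches_within G n \<longleftrightarrow> gdiam G \<le> ereal (real n)"
  by (simp add: reaches_within_iff_gdist gdiam_def SUP_le_iff)

lemma reaches_within_mono: "reaches_within G m \<Longrightarrow> m \<le> n \<Longrightarrow> reaches_within G n"
  unfolding reaches_within_def by (meson order_trans)

text \<open>Distances are lengths of geodesics, hence natural numbers: one that exceeds n is at
  least n + 1.\<close>

lemma gdiam_ge_Suc:
  assumes "\<not> reaches_within G n"
  shows "ereal (real (Suc n)) \<le> gdiam G"
proof -
  obtain u v where uv: "u \<in> verts G" "v \<in> verts G" "\<not> gdist G u v \<le> ereal (real n)"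
    using assms by (auto simp: reaches_within_iff_gdist)
  then obtain p where "geodesic G u p v"
    using ex_geodesic by blast
  then have p: "gdist G u v = ereal (real (length p))"
    by (simp add: geodesic_def)
  then have "Suc n \<le> length p"
    using uv(3) by simp
  then have "ereal (real (Suc n)) \<le> gdist G u v"
    unfolding p ereal_less_eq(3) of_nat_le_iff .
  also have "\<dots> \<le> gdiam G"
    unfolding gdiam_def using uv by (auto intro: SUP_upper2)
  finally show ?thesis .
qed

lemma gdiam_eq_Suc_iff:
  "gdiam G = ereal (real (Suc n)) \<longleftrightarrow> reaches_within G (Suc n) \<and> \<not> reaches_within G n"
  using gdiam_ge_Suc[of n] by (auto simp: reaches_within_iff_gdiam intro: antisym)

lemma not_reaches_within_0: "\<not> reaches_within G 0"
proof -
  obtain u v where "u \<in> verts G" "v \<in> verts G" "u \<noteq> v"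
    using two_verts by (auto simp: numeral_2_eq_2 card_le_Suc_iff)
  then show ?thesis
    by (auto simp: reaches_within_def apath_Nil_iff)
qed

lemma complete_iff_reaches_within: "complete_graph G \<longleftrightarrow> reaches_within G 1"
proof
  assume "complete_graph G"
  then have adj: "(u, v) \<in> arcs_ends G" if "u \<in> verts G" "v \<in> verts G" "u \<noteq> v" for u v
    using that by (auto simp: complete_graph_def complete_digraph_def)
  show "reaches_within G 1"
    unfolding reaches_within_def
  proof (intro ballI)
    fix u v assume uv: "u \<in> verts G" "v \<in> verts G"
    show "\<exists>p. gpath G u p v \<and> length p \<le> 1"
    proof (cases "u = v")
      case True
      then have "gpath G u [] v" using uv by (simp add: apath_Nil_iff)
      then show ?thesis by force
    next
      case False
      then obtain e where "e \<in> arcs G" "tail G e = u" "head G e = v"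
        using adj[OF uv] by blast
      then have "gpath G u [e] v"
        using False uv by (simp add: apath_simps)
      then show ?thesis by force
    qed
  qed
next
  assume short: "reaches_within G 1"
  have "(u, v) \<in> arcs_ends G" if uv: "u \<in> verts G" "v \<in> verts G" "u \<noteq> v" for u v
  proof -
    obtain p where p: "gpath G u p v" "length p \<le> 1"
      using short uv by (auto simp: reaches_within_def)
    then obtain e where "p = [e]"
      using uv(3) by (cases p) (auto simp: apath_Nil_iff)
    then show ?thesis
      using p by (auto simp: apath_simps in_arcs_imp_in_arcs_ends)
  qed
  then have "arcs_ends G = {(u,v). (u,v) \<in> verts G \<times> verts G \<and> u \<noteq> v}"
    by (auto dest: adj_in_verts adj_not_same)
  then show "complete_graph G"
    by (simp add: complete_graph_def complete_digraph_def graph_axioms)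
qed

section \<open>Rainbow paths: injective colourings, length bounds and short paths\<close>

lemma distinct_uedges:
  assumes "apath u p v"
  shows "distinct (map (uedge G) p)"
  using assms
proof (induction p arbitrary: u)
  case (Cons e es)
  then have es: "apath (head G e) es v" and e: "tail G e \<notin> set (awalk_verts (head G e) es)"
    by (auto simp: apath_Cons_iff)
  \<comment> \<open>Both ends of a later arc lie on the rest of the path, which avoids the tail of
    \<open>e\<close>. This excludes the arc opposite to \<open>e\<close> as well.\<close>
  have "uedge G f \<noteq> uedge G e" if "f \<in> set es" for f
    using that e awalk_verts_arc1[OF that] awalk_verts_arc2[OF awalkI_apath[OF es] that]
    by (auto simp: uedge_def doubleton_eq_iff)
  then show ?case
    using Cons.IH[OF es] by auto
qed simp

lemma uedges_of_apath: "apath u p v \<Longrightarrow> uedge G ` set p \<subseteq> uedges G"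
  by (auto simp: apath_def uedges_def)

text \<open>The truncated subtraction is right for the empty path too, which has one vertex and no
  internal one.\<close>

lemma length_internal_verts: "length (internal_verts G u p) = length p - 1"
  by (simp add: internal_verts_def length_awalk_verts)

lemma distinct_internal_verts: "apath u p v \<Longrightarrow> distinct (internal_verts G u p)"
  by (simp add: internal_verts_def apath_def distinct_butlast distinct_tl)

lemma internal_verts_of_apath: "apath u p v \<Longrightarrow> set (internal_verts G u p) \<subseteq> verts G"
  unfolding internal_verts_def apath_def
  by (auto dest!: in_set_butlastD list.set_sel(2)[rotated])

lemma rainbow_inj:
  assumes "inj_on c (uedges G)" "apath u p v"
  shows "rainbow G c p"
  using distinct_uedges[OF assms(2)] inj_on_subset[OF assms(1) uedges_of_apath[OF assms(2)]]
  by (simp add: rainbow_def distinct_map inj_on_def)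

lemma vertex_rainbow_inj:
  assumes "inj_on c (verts G)" "apath u p v"
  shows "vertex_rainbow G c u p"
  using distinct_internal_verts[OF assms(2)]
    inj_on_subset[OF assms(1) internal_verts_of_apath[OF assms(2)]]
  by (simp add: vertex_rainbow_def distinct_map)

lemma total_rainbow_inj:
  assumes c: "inj_on c (verts G <+> uedges G)" and p: "apath u p v"
  shows "total_rainbow G c u p"
proof -
  \<comment> \<open>The tags \<open>Inr\<close> and \<open>Inl\<close> keep edges and vertices
    apart, so the two halves of the list can be treated separately.\<close>
  let ?xs = "map (\<lambda>e. Inr (uedge G e)) p @ map Inl (internal_verts G u p)"
  have "distinct ?xs"
    using distinct_uedges[OF p] distinct_internal_verts[OF p]
    by (auto simp: distinct_map inj_on_def)
  moreover have "set ?xs \<subseteq> verts G <+> uedges G"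
    using uedges_of_apath[OF p] internal_verts_of_apath[OF p] by auto
  ultimately have "distinct (map c ?xs)"
    using inj_on_subset[OF c] by (simp only: distinct_map)
  then show ?thesis
    by (simp add: total_rainbow_def comp_def)
qed

lemma length_rainbow:
  assumes "c \<in> uedges G \<rightarrow> {1..k}" "apath u p v" "rainbow G c p"
  shows "length p \<le> k"
  using length_distinct_le[of "map (\<lambda>e. c (uedge G e)) p" k] assms uedges_of_apath[of u p v]
  by (force simp: rainbow_def)

lemma length_vertex_rainbow:
  assumes "c \<in> verts G \<rightarrow> {1..k}" "apath u p v" "vertex_rainbow G c u p"
  shows "length p \<le> k + 1"
  using length_distinct_le[of "map c (internal_verts G u p)" k] assms
    internal_verts_of_apath[of u p v]
  by (force simp: vertex_rainbow_def length_internal_verts)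

text \<open>A non-empty path with m edges has m - 1 internal vertices, so 2m - 1 distinct colours
  occur on it. The form without subtraction also covers the empty path.\<close>

lemma length_total_rainbow:
  assumes c: "c \<in> verts G <+> uedges G \<rightarrow> {1..k}" and p: "apath u p v"
    and "total_rainbow G c u p"
  shows "2 * length p \<le> k + 1"
proof -
  let ?xs = "map (\<lambda>e. c (Inr (uedge G e))) p @ map (\<lambda>w. c (Inl w)) (internal_verts G u p)"
  have "set ?xs \<subseteq> {1..k}"
    using c uedges_of_apath[OF p] internal_verts_of_apath[OF p]
    by (auto simp: Pi_iff image_subset_iff InlI InrI)
  then have "length ?xs \<le> k"
    using assms(3) by (intro length_distinct_le) (simp_all only: total_rainbow_def)
  then show ?thesis
    by (simp add: length_internal_verts)
qed

lemma rainbow_short: "length p \<le> 1 \<Longrightarrow> rainbow G c p"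
  by (cases p) (auto simp: rainbow_def)

lemma vertex_rainbow_short:
  assumes "length p \<le> 2"
  shows "vertex_rainbow G c u p"
proof -
  have "length (internal_verts G u p) \<le> 1"
    using assms by (simp add: length_internal_verts)
  then show ?thesis
    by (cases "internal_verts G u p") (auto simp: vertex_rainbow_def)
qed

lemma total_rainbow_short: "length p \<le> 1 \<Longrightarrow> total_rainbow G c u p"
  using length_internal_verts[of u p] by (cases p) (auto simp: total_rainbow_def)

section \<open>Connection by paths and by geodesics, for an arbitrary property of paths\<close>

definition rainbow_connected :: "('a \<Rightarrow> 'b awalk \<Rightarrow> bool) \<Rightarrow> bool" where
  "rainbow_connected R \<longleftrightarrow> (\<forall>u\<in>verts G. \<forall>v\<in>verts G. \<exists>p. gpath G u p v \<and> R u p)"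

text \<open>In both notions \<open>R\<close> receives the start vertex along with the arc list,
  because internal vertices are computed from the two. The edge version ignores it.\<close>

definition strongly_rainbow_connected :: "('a \<Rightarrow> 'b awalk \<Rightarrow> bool) \<Rightarrow> bool" where
  "strongly_rainbow_connected R \<longleftrightarrow> (\<forall>u\<in>verts G. \<forall>v\<in>verts G. \<exists>p. geodesic G u p v \<and> R u p)"

lemma strongly_rainbow_connected_imp: "strongly_rainbow_connected R \<Longrightarrow> rainbow_connected R"
  unfolding rainbow_connected_def strongly_rainbow_connected_def geodesic_def by blast

lemma strongly_rainbow_connected_inj:
  assumes "\<And>u v p. apath u p v \<Longrightarrow> R u p"
  shows "strongly_rainbow_connected R"
  unfolding strongly_rainbow_connected_def using ex_geodesic assms
  by (meson geodesic_def)

text \<open>A path satisfying \<open>R\<close> is a geodesic already, or some geodesic is strictly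
  shorter, has at most \<open>n\<close> arcs and satisfies \<open>R\<close> on account of its length
  alone. The instances are n = 1 for edge- and total-colourings and n = 2 for
  vertex-colourings.\<close>

lemma rainbow_connected_imp_strongly:
  assumes "rainbow_connected R"
    and "\<And>u v p. apath u p v \<Longrightarrow> R u p \<Longrightarrow> length p \<le> Suc n"
    and "\<And>u p. length p \<le> n \<Longrightarrow> R u p"
  shows "strongly_rainbow_connected R"
  unfolding strongly_rainbow_connected_def
proof (intro ballI)
  fix u v assume "u \<in> verts G" "v \<in> verts G"
  then obtain p where p: "gpath G u p v" "R u p"
    using assms(1) by (auto simp: rainbow_connected_def)
  then have "length p \<le> Suc n"
    using assms(2) by blast
  moreover obtain q where "geodesic G u q v" "q = p \<or> length q < length p"
    using geodesic_eq_or_shorter[OF p(1)] by blast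
  ultimately show "\<exists>q. geodesic G u q v \<and> R u q"
    using p(2) assms(3)[of q u] by auto
qed

lemma rainbow_connected_reaches_within:
  assumes "rainbow_connected R" "\<And>u v p. apath u p v \<Longrightarrow> R u p \<Longrightarrow> length p \<le> n"
  shows "reaches_within G n"
  using assms unfolding rainbow_connected_def reaches_within_def by meson

lemma strongly_rainbow_connected_short:
  assumes "reaches_within G n" "\<And>u p. length p \<le> n \<Longrightarrow> R u p"
  shows "strongly_rainbow_connected R"
  unfolding strongly_rainbow_connected_def
proof (intro ballI)
  fix u v assume "u \<in> verts G" "v \<in> verts G"
  then obtain p where p: "gpath G u p v" "length p \<le> n"
    using assms(1) by (auto simp: reaches_within_def)
  moreover obtain q where "geodesic G u q v" "q = p \<or> length q < length p"
    using geodesic_eq_or_shorter[OF p(1)] by blast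
  ultimately show "\<exists>q. geodesic G u q v \<and> R u q"
    using assms(2)[of q u] by auto
qed

section \<open>The six parameters as least numbers of colours\<close>

lemma finite_uedges: "finite (uedges G)"
  by (simp add: uedges_def)

lemma verts_ne: "verts G \<noteq> {}"
  using two_verts by auto

lemma uedges_ne: "uedges G \<noteq> {}"
proof
  assume "uedges G = {}"
  then have "arcs G = {}" by (simp add: uedges_def)
  then have "apath u p v \<Longrightarrow> length p \<le> 0" for u v p
    by (auto simp: apath_def awalk_def)
  then have "reaches_within G 0"
    using ex_geodesic unfolding reaches_within_def geodesic_def by meson
  then show False using not_reaches_within_0 by simp
qed

lemma rc_eq: "rc G = min_colours (uedges G) (\<lambda>c. rainbow_connected (\<lambda>u. rainbow G c))"
  by (simp add: rc_def min_colours_def rainbow_connected_def)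

lemma src_eq: "src G = min_colours (uedges G) (\<lambda>c. strongly_rainbow_connected (\<lambda>u. rainbow G c))"
  by (simp add: src_def min_colours_def strongly_rainbow_connected_def)

lemma rvc_eq: "rvc G = (if complete_graph G then 0
    else min_colours (verts G) (\<lambda>c. rainbow_connected (vertex_rainbow G c)))"
  by (simp add: rvc_def min_colours_def rainbow_connected_def)

lemma srvc_eq: "srvc G = (if complete_graph G then 0
    else min_colours (verts G) (\<lambda>c. strongly_rainbow_connected (vertex_rainbow G c)))"
  by (simp add: srvc_def min_colours_def strongly_rainbow_connected_def)

lemma trc_eq:
  "trc G = min_colours (verts G <+> uedges G) (\<lambda>c. rainbow_connected (total_rainbow G c))"
  by (simp add: trc_def min_colours_def rainbow_connected_def)

lemma strc_eq:
  "strc G = min_colours (verts G <+> uedges G) (\<lambda>c. strongly_rainbow_connected (total_rainbow G c))"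
  by (simp add: strc_def min_colours_def strongly_rainbow_connected_def)

text \<open>This and its two analogues supply the colourings that make the minima exist; the weak
  versions follow since geodesics are paths.\<close>

lemma src_feasible:
  "inj_on c (uedges G) \<Longrightarrow> strongly_rainbow_connected (\<lambda>u. rainbow G c)"
  by (blast intro: strongly_rainbow_connected_inj rainbow_inj)

lemma srvc_feasible:
  "inj_on c (verts G) \<Longrightarrow> strongly_rainbow_connected (vertex_rainbow G c)"
  by (blast intro: strongly_rainbow_connected_inj vertex_rainbow_inj)

lemma strc_feasible:
  "inj_on c (verts G <+> uedges G) \<Longrightarrow> strongly_rainbow_connected (total_rainbow G c)"
  by (blast intro: strongly_rainbow_connected_inj total_rainbow_inj)

lemmas rc_feasible = strongly_rainbow_connected_imp[OF src_feasible]
lemmas rvc_feasible = strongly_rainbow_connected_imp[OF srvc_feasible]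
lemmas trc_feasible = strongly_rainbow_connected_imp[OF strc_feasible]

lemma rc_pos: "1 \<le> rc G"
  unfolding rc_eq using finite_uedges uedges_ne rc_feasible by (rule min_colours_pos)

lemma rvc_pos: "\<not> complete_graph G \<Longrightarrow> 1 \<le> rvc G"
  unfolding rvc_eq using min_colours_pos[OF finite_verts verts_ne rvc_feasible] by simp

lemma rc_witness: "\<exists>c \<in> uedges G \<rightarrow> {1..rc G}. rainbow_connected (\<lambda>u. rainbow G c)"
  unfolding rc_eq using finite_uedges rc_feasible by (rule min_colours_witness)

lemma rvc_witness:
  assumes "\<not> complete_graph G"
  shows "\<exists>c \<in> verts G \<rightarrow> {1..rvc G}. rainbow_connected (vertex_rainbow G c)"
  unfolding rvc_eq if_not_P[OF assms] using finite_verts rvc_feasible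
  by (rule min_colours_witness)

lemma finite_elements: "finite (verts G <+> uedges G)"
  by (simp add: finite_uedges)

lemma trc_witness:
  "\<exists>c \<in> verts G <+> uedges G \<rightarrow> {1..trc G}. rainbow_connected (total_rainbow G c)"
  unfolding trc_eq using finite_elements trc_feasible by (rule min_colours_witness)

lemma trc_pos: "1 \<le> trc G"
  unfolding trc_eq using finite_elements _ trc_feasible
  by (rule min_colours_pos) (simp add: verts_ne)

section \<open>Weak against strong parameters\<close>

lemma rc_le_src: "rc G \<le> src G"
  unfolding rc_eq src_eq using finite_uedges src_feasible strongly_rainbow_connected_imp
  by (rule min_colours_mono)

lemma rvc_le_srvc: "rvc G \<le> srvc G"
  unfolding rvc_eq srvc_eq
  using min_colours_mono[OF finite_verts srvc_feasible strongly_rainbow_connected_imp] by simp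

lemma trc_le_strc: "trc G \<le> strc G"
  unfolding trc_eq strc_eq using finite_elements strc_feasible strongly_rainbow_connected_imp
  by (rule min_colours_mono)

lemma src_le_rc:
  assumes "rc G \<le> 2"
  shows "src G \<le> rc G"
  unfolding src_eq rc_eq using finite_uedges rc_feasible
proof (rule min_colours_mono)
  fix c assume c: "c \<in> uedges G \<rightarrow> {1..min_colours (uedges G) (\<lambda>c. rainbow_connected (\<lambda>u. rainbow G c))}"
    and "rainbow_connected (\<lambda>u. rainbow G c)"
  then show "strongly_rainbow_connected (\<lambda>u. rainbow G c)"
    using length_rainbow[OF c] rainbow_short assms
    by (intro rainbow_connected_imp_strongly[where n = 1]) (fastforce simp: rc_eq)+
qed

text \<open>Two colours allow two internal vertices, hence three edges. A strictly shorter path has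
  at most one internal vertex and is vertex-rainbow under any colouring.\<close>

lemma srvc_le_rvc:
  assumes "rvc G \<le> 2"
  shows "srvc G \<le> rvc G"
proof (cases "complete_graph G")
  case False
  let ?k = "min_colours (verts G) (\<lambda>c. rainbow_connected (vertex_rainbow G c))"
  have k: "?k \<le> 2"
    using assms False by (simp add: rvc_eq)
  have "min_colours (verts G) (\<lambda>c. strongly_rainbow_connected (vertex_rainbow G c)) \<le> ?k"
    using finite_verts rvc_feasible
  proof (rule min_colours_mono)
    fix c assume c: "c \<in> verts G \<rightarrow> {1..?k}" and "rainbow_connected (vertex_rainbow G c)"
    then show "strongly_rainbow_connected (vertex_rainbow G c)"
      using length_vertex_rainbow[OF c] vertex_rainbow_short k
      by (intro rainbow_connected_imp_strongly[where n = 2]) fastforce+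
  qed
  then show ?thesis
    using False by (simp add: rvc_eq srvc_eq)
qed (simp add: srvc_eq)

text \<open>Four colours still limit a total-rainbow path to two edges, as three edges and two
  internal vertices need five. A strictly shorter path has at most one edge.\<close>

lemma strc_le_trc:
  assumes "trc G \<le> 4"
  shows "strc G \<le> trc G"
  unfolding strc_eq trc_eq using finite_elements trc_feasible
proof (rule min_colours_mono)
  fix c assume c: "c \<in> verts G <+> uedges G \<rightarrow>
      {1..min_colours (verts G <+> uedges G) (\<lambda>c. rainbow_connected (total_rainbow G c))}"
    and "rainbow_connected (total_rainbow G c)"
  then show "strongly_rainbow_connected (total_rainbow G c)"
    using length_total_rainbow[OF c] total_rainbow_short assms
    by (intro rainbow_connected_imp_strongly[where n = 1]) (fastforce simp: trc_eq)+
qed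

section \<open>Diameter bounds from the weak parameters\<close>

lemma reaches_within_rc: "reaches_within G (rc G)"
proof -
  obtain c where "c \<in> uedges G \<rightarrow> {1..rc G}" "rainbow_connected (\<lambda>u. rainbow G c)"
    using rc_witness by blast
  then show ?thesis
    using length_rainbow by (blast intro: rainbow_connected_reaches_within)
qed

lemma reaches_within_rvc: "reaches_within G (rvc G + 1)"
proof (cases "complete_graph G")
  case True
  then show ?thesis
    \<comment> \<open>Here \<open>rvc G\<close> is 0 by convention and not through a colouring, but
      the bound 1 agrees with completeness.\<close>
    using reaches_within_mono[of 1] by (simp add: complete_iff_reaches_within)
next
  case False
  then obtain c where "c \<in> verts G \<rightarrow> {1..rvc G}" "rainbow_connected (vertex_rainbow G c)"
    using rvc_witness by blast
  then show ?thesis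
    using length_vertex_rainbow by (blast intro: rainbow_connected_reaches_within)
qed

lemma reaches_within_trc: "reaches_within G ((trc G + 1) div 2)"
proof -
  obtain c where c: "c \<in> verts G <+> uedges G \<rightarrow> {1..trc G}"
    and conn: "rainbow_connected (total_rainbow G c)"
    using trc_witness by blast
  show ?thesis
    using conn
  proof (rule rainbow_connected_reaches_within)
    fix u v p assume "apath u p v" "total_rainbow G c u p"
    then show "length p \<le> (trc G + 1) div 2"
      using length_total_rainbow[OF c] by fastforce
  qed
qed

section \<open>Upper bounds from explicit colourings\<close>

lemma src_complete:
  assumes "complete_graph G"
  shows "src G \<le> 1"
  unfolding src_eq
proof (rule min_colours_le[of "\<lambda>_. 1"])
  show "strongly_rainbow_connected (\<lambda>u. rainbow G (\<lambda>_. 1))"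
    using assms rainbow_short
    by (auto simp: complete_iff_reaches_within intro: strongly_rainbow_connected_short)
qed simp

lemma strc_complete:
  assumes "complete_graph G"
  shows "strc G \<le> 1"
  unfolding strc_eq
proof (rule min_colours_le[of "\<lambda>_. 1"])
  show "strongly_rainbow_connected (total_rainbow G (\<lambda>_. 1))"
    using assms total_rainbow_short
    by (auto simp: complete_iff_reaches_within intro: strongly_rainbow_connected_short)
qed simp

lemma srvc_reaches_within_2:
  assumes "reaches_within G 2"
  shows "srvc G \<le> 1"
proof -
  have "strongly_rainbow_connected (vertex_rainbow G (\<lambda>_. 1))"
    using assms vertex_rainbow_short by (rule strongly_rainbow_connected_short)
  then have "min_colours (verts G) (\<lambda>c. strongly_rainbow_connected (vertex_rainbow G c)) \<le> 1"
    by (intro min_colours_le[of "\<lambda>_. 1"]) auto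
  \<comment> \<open>For complete graphs the convention gives the value 0, which the bound also
    admits.\<close>
  then show ?thesis
    by (simp add: srvc_eq)
qed

text \<open>The edges keep an optimal colouring with at most two colours and every vertex gets the
  colour 3. A rainbow path then has at most two edges, so the colour 3 occurs at most once on
  it.\<close>

lemma trc_le_3_if_rc:
  assumes "rc G \<le> 2"
  shows "trc G \<le> 3"
proof -
  obtain c where "c \<in> uedges G \<rightarrow> {1..rc G}" and conn: "rainbow_connected (\<lambda>u. rainbow G c)"
    using rc_witness by blast
  then have c: "c \<in> uedges G \<rightarrow> {1..2}"
    using assms by (fastforce simp: Pi_iff)
  let ?c = "case_sum (\<lambda>_. 3) c"
  have "total_rainbow G ?c u p" if p: "apath u p v" "rainbow G c p" for u v p
  proof -
    have "length p \<le> 2"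
      using length_rainbow[OF c p] .
    \<comment> \<open>Distinctness under a constant colouring encodes that there is at most one
      internal vertex.\<close>
    then have "distinct (map (\<lambda>w. 3::nat) (internal_verts G u p))"
      using vertex_rainbow_short[of p "\<lambda>_. 3" u] by (simp add: vertex_rainbow_def)
    moreover have "c (uedge G e) \<noteq> 3" if "e \<in> set p" for e
      using c uedges_of_apath[OF p(1)] that by (fastforce simp: Pi_iff)
    ultimately show ?thesis
      using p(2) by (auto simp: total_rainbow_def rainbow_def)
  qed
  then have "rainbow_connected (total_rainbow G ?c)"
    using conn unfolding rainbow_connected_def by meson
  moreover have "?c \<in> verts G <+> uedges G \<rightarrow> {1..3}"
    using c by (fastforce simp: Pi_iff)
  ultimately show ?thesis
    unfolding trc_eq by (intro min_colours_le[of ?c]) auto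
qed

end

section \<open>Characterisation of the small values of the parameters\<close>

theorem theorem2p3:
  fixes G :: "('a, 'b) pre_digraph"
  assumes "graph G" and "connected G" and "card (verts G) \<ge> 2"
  shows
    "(complete_graph G \<longleftrightarrow> gdiam G = 1) \<and>
     (complete_graph G \<longleftrightarrow> rc G = 1) \<and>
     (complete_graph G \<longleftrightarrow> src G = 1) \<and>
     (complete_graph G \<longleftrightarrow> rvc G = 0) \<and>
     (complete_graph G \<longleftrightarrow> srvc G = 0) \<and>
     (complete_graph G \<longleftrightarrow> trc G = 1) \<and>
     (complete_graph G \<longleftrightarrow> strc G = 1) \<and>

     ((strc G \<ge> trc G \<and> trc G \<ge> 3) \<longleftrightarrow> \<not> complete_graph G) \<and>

     (rc G = 2 \<longleftrightarrow> src G = 2) \<and>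
     ((rvc G = 1 \<longleftrightarrow> srvc G = 1) \<and> (srvc G = 1 \<longleftrightarrow> gdiam G = 2)) \<and>
     (rvc G = 2 \<longleftrightarrow> srvc G = 2) \<and>
     (trc G = 3 \<longleftrightarrow> strc G = 3) \<and>
     (trc G = 4 \<longleftrightarrow> strc G = 4) \<and>
     (rc G = 2 \<or> src G = 2 \<longrightarrow> trc G = 3 \<and> strc G = 3) \<and>
     (rc G = 2 \<or> src G = 2 \<or> trc G = 3 \<or> strc G = 3 \<or> trc G = 4 \<or> strc G = 4 \<longrightarrow>
        rvc G = 1 \<and> srvc G = 1 \<and> gdiam G = 2)"
proof -
  interpret nontrivial_connected_graph G
    using assms by (simp add: nontrivial_connected_graph_def nontrivial_connected_graph_axioms_def)
  have diam1: "gdiam G = 1 \<longleftrightarrow> complete_graph G"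
    using gdiam_eq_Suc_iff[of 0] not_reaches_within_0 complete_iff_reaches_within
    by (simp add: one_ereal_def)
  have diam2: "gdiam G = 2 \<longleftrightarrow> reaches_within G 2 \<and> \<not> complete_graph G"
    using gdiam_eq_Suc_iff[of 1] complete_iff_reaches_within
    by (simp add: numeral_2_eq_2)
  show ?thesis
  proof (cases "complete_graph G")
    case True
    then have "rc G = 1" "src G = 1" "trc G = 1" "strc G = 1"
      using rc_pos trc_pos rc_le_src trc_le_strc src_complete strc_complete by linarith+
    moreover have "rvc G = 0" "srvc G = 0"
      using True by (simp_all add: rvc_eq srvc_eq)
    ultimately show ?thesis
      using True diam1 diam2 by simp
  next
    case False
    have rc: "2 \<le> rc G"
    proof (rule ccontr)
      assume "\<not> 2 \<le> rc G"
      then show False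
        using reaches_within_mono[OF reaches_within_rc, of 1] False complete_iff_reaches_within
        by simp
    qed
    \<comment> \<open>Two colours would leave only paths with at most one edge, since (2 + 1) div 2
      = 1; so the value 2 is excluded along with 1.\<close>
    have trc: "3 \<le> trc G"
    proof (rule ccontr)
      assume "\<not> 3 \<le> trc G"
      then show False
        using reaches_within_mono[OF reaches_within_trc, of 1] False complete_iff_reaches_within
        by simp
    qed
    \<comment> \<open>The cycle closes as follows: \<open>rvc G = 1\<close> puts all distances
      within 2, this gives \<open>srvc G \<le> 1\<close>, and 1 \<le> \<open>rvc G\<close> \<le>
      \<open>srvc G\<close> forces equality.\<close>
    have rvc: "rvc G = 1 \<longleftrightarrow> reaches_within G 2" "srvc G = 1 \<longleftrightarrow> reaches_within G 2"
      and rvc_pos: "1 \<le> rvc G"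
      using reaches_within_mono[OF reaches_within_rvc, of 2] srvc_reaches_within_2 rvc_le_srvc
        rvc_pos[OF False] srvc_le_rvc by (auto intro: antisym)
    \<comment> \<open>Since (4 + 1) div 2 = 2, the values 3 and 4 of \<open>trc G\<close> both bound
      the diameter by 2.\<close>
    have trc4: "trc G \<le> 4 \<Longrightarrow> reaches_within G 2"
      using reaches_within_mono[OF reaches_within_trc, of 2] by simp
    \<comment> \<open>If the strong parameter is 2, the weak one is at most 2, and then both agree.
      The equivalences below for \<open>rvc G\<close> and \<open>trc G\<close> follow the same
      pattern.\<close>
    have rc2: "rc G = 2 \<longleftrightarrow> src G = 2"
      using rc rc_le_src src_le_rc by linarith
    have rvc2: "rvc G = 2 \<longleftrightarrow> srvc G = 2"
      using rvc rvc_pos rvc_le_srvc srvc_le_rvc by linarith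
    have trc34: "trc G = 3 \<longleftrightarrow> strc G = 3" "trc G = 4 \<longleftrightarrow> strc G = 4"
      using trc trc_le_strc strc_le_trc by linarith+
    have rc_trc: "rc G = 2 \<Longrightarrow> trc G = 3"
      using trc trc_le_3_if_rc by simp
    have "rc G \<noteq> 1" "src G \<noteq> 1" "rvc G \<noteq> 0" "srvc G \<noteq> 0" "trc G \<noteq> 1" "strc G \<noteq> 1"
      using rc trc rvc_pos rc_le_src rvc_le_srvc trc_le_strc by linarith+
    then show ?thesis
      using False diam1 diam2 trc trc_le_strc rvc rc2 rvc2 trc34 rc_trc trc4 by auto
  qed
qed

end
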